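(* Let $0<\varepsilon<1$ and let $w$ be any $\varepsilon$-Beck word. Then $w$ is not infinite closed-rich. Moreover, for each real constant $C>0$ there exists $N_0$ such that for every $N\ge N_0$, every factor of $w$ of length $N$ contains fewer than $CN^2$ distinct closed factors.
   Context: For a real $\varepsilon>0$, an infinite binary word $w$ is an $\varepsilon$-Beck word (Beck word with parameter $\varepsilon$) if there exists an integer $N_\varepsilon$ such that for every factor $x$ of $w$ of length $n>N_\varepsilon$, any two distinct occurrences of $x$ in $w$ are separated by a distance of at least $(2-\varepsilon)^n$, i.e., there are at least $(2-\varepsilon)^n$ letters between the end of the earlier occurrence and the beginning of the later one (in particular they do not overlap). A factor of a word is a contiguous finite subword. A border of a finite word $v$ is a proper prefix of $v$ which is also a suffix of $v$. A finite word $v$ is closed if $|v|\le 1$, or if $|v|\ge 2$ and the longest border of $v$ is non-empty and occurs in $v$ exactly twice (as a prefix and as a suffix). An infinite word $w$ is (infinite) closed-rich if there exists a constant $c>0$ such that for each $n\in\mathbb{N}$ each factor of $w$ of length $n$ contains at least $cn^2$ distinct closed factors. *)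

theory Defs
  imports Complex_Main "HOL-Library.Omega_Words_Fun" "HOL-Library.Sublist"
begin

text \<open>
  Infinite words are functions \<open>nat \<Rightarrow> 'a\<close>, finite words are lists, and the binary
  alphabet is \<^typ>\<open>bool\<close>. Both imported theories define constants called \<open>prefix\<close> and
  \<open>suffix\<close>; those on lists are written with their theory name.
\<close>

definition occurs_at :: "'a list \<Rightarrow> 'a word \<Rightarrow> nat \<Rightarrow> bool" where
  "occurs_at x w i \<longleftrightarrow> w [i \<rightarrow> i + length x] = x"

definition factor :: "'a list \<Rightarrow> 'a word \<Rightarrow> bool" where
  "factor x w \<longleftrightarrow> (\<exists>i. occurs_at x w i)"

text \<open>
  The number of letters between the end of an occurrence at \<open>i\<close> and the beginning of a later
  one at \<open>j\<close> is \<open>j - (i + length x)\<close>. The subtraction is taken in the reals: on the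
  naturals it would truncate to zero for overlapping occurrences.
\<close>

definition beck_word :: "real \<Rightarrow> bool word \<Rightarrow> bool" where
  "beck_word \<epsilon> w \<longleftrightarrow>
     (\<exists>N::int. \<forall>x. factor x w \<and> int (length x) > N \<longrightarrow>
        (\<forall>i j. occurs_at x w i \<and> occurs_at x w j \<and> i < j \<longrightarrow>
           real j - real (i + length x) \<ge> (2 - \<epsilon>) ^ length x))"

definition border :: "'a list \<Rightarrow> 'a list \<Rightarrow> bool" where
  "border b v \<longleftrightarrow> Sublist.strict_prefix b v \<and> Sublist.suffix b v"

definition longest_border :: "'a list \<Rightarrow> 'a list \<Rightarrow> bool" where
  "longest_border b v \<longleftrightarrow> border b v \<and> (\<forall>b'. border b' v \<longrightarrow> length b' \<le> length b)"

definition occurrences :: "'a list \<Rightarrow> 'a list \<Rightarrow> nat set" where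
  "occurrences x v = {i. i + length x \<le> length v \<and> take (length x) (drop i v) = x}"

text \<open>
  A border occurs as a prefix and as a suffix, at two different positions, so having exactly
  two occurrences means having no others.
\<close>

definition closed_word :: "'a list \<Rightarrow> bool" where
  "closed_word v \<longleftrightarrow> length v \<le> 1 \<or>
     (length v \<ge> 2 \<and> (\<exists>b. longest_border b v \<and> b \<noteq> [] \<and> card (occurrences b v) = 2))"

definition closed_factors :: "'a list \<Rightarrow> 'a list set" where
  "closed_factors u = {v. sublist v u \<and> closed_word v}"

definition closed_rich :: "'a word \<Rightarrow> bool" where
  "closed_rich w \<longleftrightarrow>
     (\<exists>c::real. c > 0 \<and>
        (\<forall>n::nat. \<forall>u. factor u w \<and> length u = n \<longrightarrow>
           real (card (closed_factors u)) \<ge> c * real n ^ 2))"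

end

theory Submission
  imports Defs "HOL-Real_Asymp.Real_Asymp"
begin

text \<open>
  A closed word is the complete return to its longest border \<open>b\<close>, so a closed factor of \<open>u\<close> is
  determined by the position of one of its occurrences and by the length of \<open>b\<close>. Both copies
  of \<open>b\<close> lie in \<open>u\<close>, hence the Beck condition gives \<open>(2 - \<epsilon>) ^ length b \<le> length u\<close> as soon
  as \<open>b\<close> is long enough, and only \<open>O(log N)\<close> border lengths are possible in a factor of length
  \<open>N\<close>. So there are only \<open>O(N log N)\<close> closed factors.
\<close>

text \<open>The form in which closedness is used: \<open>b\<close> may be empty, so that one-letter
  words fall under the same argument as longer closed words.\<close>

definition complete_return :: "'a list \<Rightarrow> 'a list \<Rightarrow> bool" where
  "complete_return b v \<longleftrightarrow> border b v \<and> card (occurrences b v) = 2"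

lemma occurrences_append: "length xs \<in> occurrences b (xs @ b @ ys)"
  by (simp add: occurrences_def)

lemma finite_occurrences: "finite (occurrences b v)"
  by (rule finite_subset[of _ "{..length v}"]) (auto simp: occurrences_def)

lemma borderE:
  assumes "border b v"
  obtains xs ys where "v = xs @ b" "v = b @ ys" "xs \<noteq> []"
proof -
  from assms obtain xs ys where "v = xs @ b" "v = b @ ys" "ys \<noteq> []"
    unfolding border_def by (auto simp: suffix_def strict_prefix_def prefix_def)
  moreover from this have "xs \<noteq> []" by auto
  ultimately show thesis using that by blast
qed

text \<open>If \<open>v\<close> were shorter than \<open>v'\<close>, the copy of \<open>b\<close> at
  the end of \<open>v\<close> would be a third occurrence of \<open>b\<close> in \<open>v'\<close>,
  strictly between the initial and the final one.\<close>

lemma complete_return_unique_prefix: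
  assumes v: "complete_return b v" and v': "complete_return b v'" and "Sublist.prefix v v'"
  shows "v = v'"
proof (rule ccontr)
  assume "v \<noteq> v'"
  with assms(3) obtain zs where zs: "v' = v @ zs" "zs \<noteq> []"
    by (auto simp: prefix_def)
  from v have "border b v" by (simp add: complete_return_def)
  then obtain xs ys where xs: "v = xs @ b" "v = b @ ys" "xs \<noteq> []" by (rule borderE)
  from v' have "border b v'" by (simp add: complete_return_def)
  then obtain xs' ys' where xs': "v' = xs' @ b" "v' = b @ ys'" "xs' \<noteq> []" by (rule borderE)
  have "length v' = length v + length zs" by (simp add: zs)
  then have "length xs < length xs'" using zs(2) by (simp add: xs(1) xs'(1))
  moreover have "0 \<in> occurrences b v'"
    using occurrences_append[of "[]" b ys'] xs'(2) by simp
  moreover have "length xs \<in> occurrences b v'"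
    using occurrences_append[of xs b zs] zs xs(1) by simp
  moreover have "length xs' \<in> occurrences b v'"
    using occurrences_append[of xs' b "[]"] xs'(1) by simp
  ultimately have "card {0, length xs, length xs'} \<le> card (occurrences b v')"
    by (intro card_mono finite_occurrences) auto
  moreover have "card {0, length xs, length xs'} = 3"
    using xs(3) xs'(3) \<open>length xs < length xs'\<close> by auto
  ultimately show False using v' by (simp add: complete_return_def)
qed

text \<open>Both borders are prefixes of \<open>s\<close> of the same length, hence equal;
  \<open>v\<close> and \<open>v'\<close> are comparable as prefixes of \<open>s\<close>.\<close>

lemma complete_return_unique:
  assumes "complete_return b v" "complete_return b' v'" "length b = length b'"
    and "Sublist.prefix v s" "Sublist.prefix v' s"
  shows "v = v'"
proof -
  have "Sublist.prefix b s" "Sublist.prefix b' s"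
    using assms by (auto simp: complete_return_def border_def strict_prefix_def intro: prefix_order.trans)
  then have "b = b'" using assms(3) by (auto simp: prefix_def)
  then show ?thesis
    using assms complete_return_unique_prefix prefix_same_cases by metis
qed

text \<open>One-letter words are complete returns to the empty word.\<close>

lemma closed_word_complete_return:
  assumes "closed_word v" "v \<noteq> []"
  obtains b where "complete_return b v"
proof (cases "length v \<le> 1")
  case True
  with assms(2) obtain a where "v = [a]" by (cases v) auto
  moreover have "occurrences [] [a] = {0, 1}" by (auto simp: occurrences_def)
  ultimately have "complete_return [] v"
    by (auto simp: complete_return_def border_def strict_prefix_def)
  then show thesis by (rule that)
next
  case False
  with assms(1) obtain b where "longest_border b v" "card (occurrences b v) = 2"
    unfolding closed_word_def by auto
  then show thesis by (intro that[of b]) (simp add: complete_return_def longest_border_def)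
qed

lemma card_closed_factors_le:
  assumes bound: "\<And>i b v. complete_return b v \<Longrightarrow> Sublist.prefix v (drop i u) \<Longrightarrow> length b < K"
  shows "card (closed_factors u) \<le> 1 + length u * K"
proof -
  \<comment> \<open>The empty word is closed but has no border; it accounts for the summand 1 in the
    bound.\<close>
  define A where "A = closed_factors u - {[]}"
  \<comment> \<open>A factor may occur at several positions, so the coding by position and border
    length starts as a relation; \<open>f\<close> then chooses one code for each factor.\<close>
  define R where "R = (\<lambda>v (i, k). i < length u \<and> Sublist.prefix v (drop i u) \<and>
    (\<exists>b. complete_return b v \<and> length b = k))"
  have "\<exists>p. R v p" if "v \<in> A" for v
  proof -
    from that have v: "sublist v u" "closed_word v" "v \<noteq> []"
      by (auto simp: A_def closed_factors_def)
    from v(1) obtain ps ss where u: "u = ps @ v @ ss" by (auto simp: sublist_def)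
    from v(2,3) obtain b where "complete_return b v" by (rule closed_word_complete_return)
    then have "R v (length ps, length b)" using v(3) by (auto simp: R_def u)
    then show ?thesis ..
  qed
  then obtain f where f: "\<And>v. v \<in> A \<Longrightarrow> R v (f v)" by metis
  have "inj_on f A"
  proof (rule inj_onI)
    fix v v' assume "v \<in> A" "v' \<in> A" "f v = f v'"
    then have "R v (f v)" "R v' (f v)" using f by metis+
    then show "v = v'" by (auto simp: R_def intro: complete_return_unique)
  qed
  moreover have "f ` A \<subseteq> {..<length u} \<times> {..<K}"
  proof (rule image_subsetI)
    fix v assume "v \<in> A"
    then have "R v (f v)" by (rule f)
    then show "f v \<in> {..<length u} \<times> {..<K}" by (auto simp: R_def dest: bound)
  qed
  ultimately have "card A \<le> card ({..<length u} \<times> {..<K})"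
    by (rule card_inj_on_le) simp
  moreover have "card (closed_factors u) \<le> card A + 1"
    using card_Diff1_le diff_card_le_card_Diff[of "{[]}" "closed_factors u"] by (simp add: A_def)
  ultimately show ?thesis by (simp add: card_cartesian_product)
qed

lemma occurs_at_append:
  assumes "occurs_at (xs @ x @ ys) w p"
  shows "occurs_at x w (p + length xs)"
proof (unfold occurs_at_def, rule nth_equalityI)
  fix t assume t: "t < length (w [p + length xs \<rightarrow> p + length xs + length x])"
  have eq: "w [p \<rightarrow> p + length (xs @ x @ ys)] = xs @ x @ ys"
    using assms by (simp add: occurs_at_def)
  have "w [p \<rightarrow> p + length (xs @ x @ ys)] ! (length xs + t) = w (p + length xs + t)"
    using t by (subst subsequence_nth) (auto simp: add.assoc)
  moreover have "(xs @ x @ ys) ! (length xs + t) = x ! t"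
    using t by (simp add: nth_append)
  ultimately show "w [p + length xs \<rightarrow> p + length xs + length x] ! t = x ! t"
    unfolding eq using t by simp
qed simp

text \<open>The two copies of \<open>b\<close> at the ends of \<open>v\<close> are distinct
  occurrences in \<open>w\<close>, and the gap between them lies inside \<open>u\<close>.\<close>

lemma complete_return_in_beck_word:
  assumes beck: "\<And>x i j. M < int (length x) \<Longrightarrow> occurs_at x w i \<Longrightarrow> occurs_at x w j \<Longrightarrow> i < j \<Longrightarrow>
      q ^ length x \<le> real j - real (i + length x)"
    and u: "occurs_at u w p" and v: "complete_return b v" "Sublist.prefix v (drop i u)"
    and long: "M < int (length b)"
  shows "q ^ length b \<le> real (length u)"
proof -
  from v(2) obtain ss where "drop i u = v @ ss" by (auto simp: prefix_def)
  then have u_eq: "u = take i u @ v @ ss" using append_take_drop_id[of i u] by simp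
  from v(1) have "border b v" by (simp add: complete_return_def)
  then obtain xs ys where xs: "v = xs @ b" "v = b @ ys" "xs \<noteq> []" by (rule borderE)
  define P where "P = take i u"
  have u1: "u = P @ b @ (ys @ ss)" and u2: "u = (P @ xs) @ b @ ss"
    using u_eq xs by (simp_all add: P_def) (metis append_assoc)
  have "occurs_at b w (p + length P)" "occurs_at b w (p + length (P @ xs))"
    using u u1 u2 occurs_at_append by metis+
  then have "q ^ length b \<le> real (p + length (P @ xs)) - real (p + length P + length b)"
    using xs(3) by (intro beck long) auto
  also have "\<dots> \<le> real (length u)" by (subst u2) simp
  finally show ?thesis .
qed

lemma beck_word_closed_factors:
  fixes \<epsilon> :: real
  assumes "\<epsilon> < 1" "beck_word \<epsilon> w" "C > 0"
  shows "\<exists>N0. \<forall>N\<ge>N0. \<forall>u. factor u w \<and> length u = N \<longrightarrow>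
    real (card (closed_factors u)) < C * real N ^ 2"
proof -
  define q where "q = 2 - \<epsilon>"
  have q: "q > 1" using assms(1) by (simp add: q_def)
  obtain M where beck: "\<And>x i j. M < int (length x) \<Longrightarrow> occurs_at x w i \<Longrightarrow> occurs_at x w j \<Longrightarrow>
      i < j \<Longrightarrow> q ^ length x \<le> real j - real (i + length x)"
    using assms(2) unfolding beck_word_def q_def factor_def by blast
  \<comment> \<open>With this \<open>a\<close>, the inequality \<open>q ^ k \<le> N\<close> becomes
    \<open>k \<le> a * ln N\<close>.\<close>
  define a where "a = 1 / ln q"
  define B where "B = real (nat M) + 2"
  have "a > 0" using q by (simp add: a_def)
  then have "eventually (\<lambda>N::nat. 1 + real N * (B + a * ln (real N)) < C * real N ^ 2) at_top"
    using \<open>C > 0\<close> by real_asymp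
  then obtain N0 where N0: "\<And>N. N \<ge> N0 \<Longrightarrow> 1 + real N * (B + a * ln (real N)) < C * real N ^ 2"
    by (auto simp: eventually_at_top_linorder)
  show ?thesis
  \<comment> \<open>Taking \<open>N \<ge> 1\<close> makes \<open>ln N\<close> non-negative, so that
    \<open>nat\<close> does not truncate in \<open>K\<close>, and lets \<open>ln\<close> be applied
    to the Beck inequality.\<close>
  proof (intro exI[of _ "max N0 1"] allI impI, elim conjE)
    fix N u assume N: "max N0 1 \<le> N" and "factor u w" and len: "length u = N"
    then obtain p where p: "occurs_at u w p" by (auto simp: factor_def)
    have log_nonneg: "0 \<le> a * ln (real N)" using \<open>a > 0\<close> N by simp
    \<comment> \<open>Borders too short for the Beck condition have length at most
      \<open>nat M\<close>, the others at most the floor; the final 1 makes the bound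
      strict.\<close>
    define K where "K = nat M + nat \<lfloor>a * ln (real N)\<rfloor> + 1"
    have "length b < K" if b: "complete_return b v" "Sublist.prefix v (drop i u)" for b v i
    proof (cases "M < int (length b)")
      case True
      with p b have "q ^ length b \<le> real N"
        using complete_return_in_beck_word[OF beck] len by blast
      then have "ln (q ^ length b) \<le> ln (real N)"
        using q N by simp
      then have "real (length b) \<le> a * ln (real N)"
        using q by (simp add: a_def ln_realpow field_simps)
      then show ?thesis unfolding K_def by linarith
    qed (simp add: K_def)
    then have "card (closed_factors u) \<le> 1 + N * K"
      using card_closed_factors_le[of u K] len by blast
    then have "real (card (closed_factors u)) \<le> real (1 + N * K)" by (rule of_nat_mono)
    also have "\<dots> = 1 + real N * real K" by simp
    also have "\<dots> \<le> 1 + real N * (B + a * ln (real N))"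
    proof -
      have "real K \<le> B + a * ln (real N)" using log_nonneg unfolding K_def B_def by linarith
      then show ?thesis by (simp add: mult_left_mono)
    qed
    also have "\<dots> < C * real N ^ 2" using N by (intro N0) simp
    finally show "real (card (closed_factors u)) < C * real N ^ 2" .
  qed
qed

theorem theorem2:
  fixes \<epsilon> :: real and w :: "bool word"
  assumes "0 < \<epsilon>" and "\<epsilon> < 1" and "beck_word \<epsilon> w"
  shows "\<not> closed_rich w \<and>
    (\<forall>C::real. C > 0 \<longrightarrow>
       (\<exists>N0::nat. \<forall>N\<ge>N0. \<forall>u. factor u w \<and> length u = N \<longrightarrow>
          real (card (closed_factors u)) < C * real N ^ 2))"
proof (intro conjI allI impI)
  show "\<not> closed_rich w"
  proof
    assume "closed_rich w"
    then obtain c where "c > 0" and rich: "\<And>u. factor u w \<Longrightarrow>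
        c * real (length u) ^ 2 \<le> real (card (closed_factors u))"
      unfolding closed_rich_def by blast
    obtain N where N: "\<And>u. factor u w \<Longrightarrow> length u = N \<Longrightarrow>
        real (card (closed_factors u)) < c * real N ^ 2"
      using beck_word_closed_factors[OF assms(2,3) \<open>c > 0\<close>] by blast
    \<comment> \<open>Any factor whose length is the threshold \<open>N\<close> contradicts richness
      with constant \<open>c\<close>; the prefix of \<open>w\<close> is one.\<close>
    have u: "factor (w [0 \<rightarrow> N]) w" "length (w [0 \<rightarrow> N]) = N"
      by (auto simp: factor_def occurs_at_def intro!: exI[of _ 0])
    show False using rich[OF u(1)] N[OF u] u(2) by simp
  qed
qed (rule beck_word_closed_factors[OF assms(2,3)])

end
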